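(* Let $P$ be a pack for $PS$ with $|M_P \setminus M_0| \geq 2$, and let $s:=\sum_{ij \in P} a_{ij}$. For any $i^*j^* \in P$ with $i^* \notin M_0$, $j^* = n_{i^*}$, and any $i' \in M_P \cap M_0$, the inequality $$\begin{aligned} &\frac{a_{i^* j^*} \cdot a_{i' 1}}{a_{i^* j^*} + b - s} x_{i' 1} + \sum_{i \in M_P \setminus \{i', i^*\}} \sum_{j \in N_i} a_{ij} x_{ij} + \sum_{ij \in P,\; i \in (M_P \setminus M_0) \setminus\{ i^*\}} \left(b-s + \frac{(b-s) a_{i'1}}{a_{i^* j^*} + b - s} \right) x_{ij} \\ &\quad + a_{i^* j^*} x_{i^* j^*} + \sum_{j \in N_{i^*} \setminus\{ j^*\}} a_{i^* j^*} \max \left\{1, \frac{a_{i^* j} }{ a_{i^* j^*} + b - s} \right\} x_{i^* j} \\ &\leq b + (|M_P \setminus M_0| - 2) (b-s) \left(1 + \frac{ a_{i'1}}{a_{i^* j^*} + b - s}\right) \end{aligned}$$ is valid for $PS$. Furthermore, when $P \setminus\{ (i',1)\}$ is a maximal switching pack, this inequality is facet-defining for $PS$.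
   Context: Let $M=\{1,\dots,m\}$, $N_i=\{1,\dots,n_i\}$ for $i\in M$, $I=\{(i,j)\mid i\in M, j\in N_i\}$ (the pair $(i,j)$ is also written $ij$), $d=\sum_{i\in M} n_i$, and let $b\in\mathbb{R}_+$, $a_{ij}\in\mathbb{R}_+$ for $ij\in I$. Let $S$ be the set of $x\in[0,1]^d$ (with coordinates $x_{ij}$, $ij\in I$) satisfying $\sum_{i\in M}\sum_{j\in N_i}a_{ij}x_{ij}\le b$ and $x_{ij}\cdot x_{ij'}=0$ for all $i\in M$, $j\ne j'\in N_i$. The complementarity knapsack polytope is $PS=\operatorname{conv}(S)$. Let $M_0=\{i\in M\mid n_i=1\}$. Standing assumptions: $M\ne M_0$; $\sum_{i\in M}\max\{a_{i1},\dots,a_{in_i}\}>b$; $b>0$ and $a_{ij}\ge 0$ for all $ij\in I$; $a_{i1}\ge\dots\ge a_{in_i}$ for all $i\in M\setminus M_0$. For $T\subseteq I$, $M_T=\{i\in M\mid ij\in T\text{ for some } j\in N_i\}$. A pack is a set $P=\{i_1j_1,\dots,i_kj_k\}\subset I$ with $i_1,\dots,i_k$ all distinct and $\sum_{ij\in P}a_{ij}<b$. A pack $P$ is a maximal switching pack if $j=n_i$ for every $ij\in P$, and $\sum_{ij\in P}a_{ij}-a_{i'n_{i'}}+a_{i',n_{i'}-1}>b$ for every $i'\in M_P\setminus M_0$.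
   Formalization: The facet claim additionally assumes that a_{i*j*} > 0, or |M_P \ M_0| = 2, or a_{i1} > 0 for some i in (M_P ∩ M_0) \ {i'}; without this the inequality is valid but never facet-defining. *)

theory Defs
  imports "HOL-Analysis.Analysis"
begin

text \<open>
  An instance is given by \<open>m\<close>, \<open>n\<close>, \<open>a\<close>, \<open>b\<close>, all indices starting at 1. The ambient space of
  dimension \<open>d = n 1 + \<dots> + n m\<close> is \<open>real^'k\<close>, where \<open>ix\<close> labels the coordinates bijectively by
  the pairs in \<open>index_set m n\<close>; the variable \<open>x\<^sub>i\<^sub>j\<close> is \<open>x $ ix i j\<close>. Values of \<open>ix\<close> and \<open>a\<close>
  outside \<open>index_set m n\<close> are irrelevant.
\<close>

definition index_set :: "nat \<Rightarrow> (nat \<Rightarrow> nat) \<Rightarrow> (nat \<times> nat) set" where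
  "index_set m n = (SIGMA i:{1..m}. {1..n i})"

definition coordinate_labelling ::
    "nat \<Rightarrow> (nat \<Rightarrow> nat) \<Rightarrow> (nat \<Rightarrow> nat \<Rightarrow> 'k::finite) \<Rightarrow> bool" where
  "coordinate_labelling m n ix \<longleftrightarrow> bij_betw (\<lambda>(i, j). ix i j) (index_set m n) UNIV"

definition ck_set ::
    "nat \<Rightarrow> (nat \<Rightarrow> nat) \<Rightarrow> (nat \<Rightarrow> nat \<Rightarrow> real) \<Rightarrow> real \<Rightarrow> (nat \<Rightarrow> nat \<Rightarrow> 'k::finite) \<Rightarrow> (real^'k) set"
  where
  "ck_set m n a b ix =
    {x. (\<forall>i\<in>{1..m}. \<forall>j\<in>{1..n i}. 0 \<le> x $ ix i j \<and> x $ ix i j \<le> 1) \<and>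
        (\<Sum>i\<in>{1..m}. \<Sum>j\<in>{1..n i}. a i j * x $ ix i j) \<le> b \<and>
        (\<forall>i\<in>{1..m}. \<forall>j\<in>{1..n i}. \<forall>j'\<in>{1..n i}.
            j \<noteq> j' \<longrightarrow> x $ ix i j * x $ ix i j' = 0)}"

definition ck_polytope ::
    "nat \<Rightarrow> (nat \<Rightarrow> nat) \<Rightarrow> (nat \<Rightarrow> nat \<Rightarrow> real) \<Rightarrow> real \<Rightarrow> (nat \<Rightarrow> nat \<Rightarrow> 'k::finite) \<Rightarrow> (real^'k) set"
  where
  "ck_polytope m n a b ix = convex hull (ck_set m n a b ix)"

definition M0 :: "nat \<Rightarrow> (nat \<Rightarrow> nat) \<Rightarrow> nat set" where
  "M0 m n = {i\<in>{1..m}. n i = 1}"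

definition M_of :: "nat \<Rightarrow> (nat \<Rightarrow> nat) \<Rightarrow> (nat \<times> nat) set \<Rightarrow> nat set" where
  "M_of m n T = {i\<in>{1..m}. \<exists>j\<in>{1..n i}. (i, j) \<in> T}"

definition ck_standing ::
    "nat \<Rightarrow> (nat \<Rightarrow> nat) \<Rightarrow> (nat \<Rightarrow> nat \<Rightarrow> real) \<Rightarrow> real \<Rightarrow> bool" where
  "ck_standing m n a b \<longleftrightarrow>
    (\<forall>i\<in>{1..m}. 1 \<le> n i) \<and>
    {1..m} \<noteq> M0 m n \<and>
    (\<Sum>i\<in>{1..m}. Max (a i ` {1..n i})) > b \<and>
    b > 0 \<and>
    (\<forall>(i, j)\<in>index_set m n. 0 \<le> a i j) \<and>
    (\<forall>i\<in>{1..m} - M0 m n. \<forall>j\<in>{1..n i}. \<forall>j'\<in>{1..n i}. j \<le> j' \<longrightarrow> a i j' \<le> a i j)"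

definition weight :: "(nat \<Rightarrow> nat \<Rightarrow> real) \<Rightarrow> (nat \<times> nat) set \<Rightarrow> real" where
  "weight a P = (\<Sum>(i, j)\<in>P. a i j)"

definition pack ::
    "nat \<Rightarrow> (nat \<Rightarrow> nat) \<Rightarrow> (nat \<Rightarrow> nat \<Rightarrow> real) \<Rightarrow> real \<Rightarrow> (nat \<times> nat) set \<Rightarrow> bool" where
  "pack m n a b P \<longleftrightarrow> P \<subseteq> index_set m n \<and> inj_on fst P \<and> weight a P < b"

definition maximal_switching_pack ::
    "nat \<Rightarrow> (nat \<Rightarrow> nat) \<Rightarrow> (nat \<Rightarrow> nat \<Rightarrow> real) \<Rightarrow> real \<Rightarrow> (nat \<times> nat) set \<Rightarrow> bool" where
  "maximal_switching_pack m n a b P \<longleftrightarrow>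
    pack m n a b P \<and>
    (\<forall>(i, j)\<in>P. j = n i) \<and>
    (\<forall>i\<in>M_of m n P - M0 m n. weight a P - a i (n i) + a i (n i - 1) > b)"

definition valid_ineq :: "('v \<Rightarrow> real) \<Rightarrow> real \<Rightarrow> 'v set \<Rightarrow> bool" where
  "valid_ineq f \<beta> C \<longleftrightarrow> (\<forall>x\<in>C. f x \<le> \<beta>)"

definition facet_defining :: "('v::euclidean_space \<Rightarrow> real) \<Rightarrow> real \<Rightarrow> 'v set \<Rightarrow> bool" where
  "facet_defining f \<beta> C \<longleftrightarrow> valid_ineq f \<beta> C \<and> {x\<in>C. f x = \<beta>} facet_of C"

text \<open>
  The two sides of the lifted inequality; \<open>(p, q)\<close> is the distinguished pair
  \<open>(i\<^sup>*, j\<^sup>*)\<close> and \<open>r\<close> the distinguished index \<open>i'\<close>.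

  If \<open>a p q = 0\<close>, then \<open>p\<close> and \<open>r\<close> drop out of the inequality. It then fails to define a facet
  when in addition at least three indices in \<open>M_of m n P - M0 m n\<close> occur and \<open>a i 1 = 0\<close> for all
  \<open>i \<in> M_of m n P \<inter> M0 m n - {r}\<close>. For example, take \<open>m = 4\<close>, \<open>n = (1,2,2,2)\<close>, \<open>b = 10\<close>,
  \<open>a 1 1 = 1\<close>, \<open>a 2 = (20,0)\<close>, \<open>a 3 = a 4 = (20,1)\<close>, \<open>P = {(1,1),(2,2),(3,2),(4,2)}\<close>,
  \<open>(p,q) = (2,2)\<close>, \<open>r = 1\<close>: the inequality is
  \<open>20 x\<^sub>3\<^sub>1 + 9 x\<^sub>3\<^sub>2 + 20 x\<^sub>4\<^sub>1 + 9 x\<^sub>4\<^sub>2 \<le> 18\<close>, and in these four variables only three points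
  of the feasible set satisfy it with equality.
\<close>

definition lifted_lhs ::
    "nat \<Rightarrow> (nat \<Rightarrow> nat) \<Rightarrow> (nat \<Rightarrow> nat \<Rightarrow> real) \<Rightarrow> real \<Rightarrow> (nat \<Rightarrow> nat \<Rightarrow> 'k::finite) \<Rightarrow>
      (nat \<times> nat) set \<Rightarrow> nat \<Rightarrow> nat \<Rightarrow> nat \<Rightarrow> real^'k \<Rightarrow> real" where
  "lifted_lhs m n a b ix P p q r x =
    (let s = weight a P in
      (a p q * a r 1) / (a p q + b - s) * x $ ix r 1
      + (\<Sum>i\<in>M_of m n P - {r, p}. \<Sum>j\<in>{1..n i}. a i j * x $ ix i j)
      + (\<Sum>(i, j)\<in>{(i, j)\<in>P. i \<in> (M_of m n P - M0 m n) - {p}}.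
            (b - s + ((b - s) * a r 1) / (a p q + b - s)) * x $ ix i j)
      + a p q * x $ ix p q
      + (\<Sum>j\<in>{1..n p} - {q}. a p q * max 1 (a p j / (a p q + b - s)) * x $ ix p j))"

definition lifted_rhs ::
    "nat \<Rightarrow> (nat \<Rightarrow> nat) \<Rightarrow> (nat \<Rightarrow> nat \<Rightarrow> real) \<Rightarrow> real \<Rightarrow>
      (nat \<times> nat) set \<Rightarrow> nat \<Rightarrow> nat \<Rightarrow> nat \<Rightarrow> real" where
  "lifted_rhs m n a b P p q r =
    (let s = weight a P in
      b + (real (card (M_of m n P - M0 m n)) - 2) * (b - s) * (1 + a r 1 / (a p q + b - s)))"

end

theory Submission
  imports Defs
begin

text \<open>
  Write \<open>\<delta> = b - s\<close>, \<open>D = a p q + \<delta>\<close>, \<open>\<kappa> = \<delta> (1 + a r 1 / D)\<close> and let \<open>L\<close> be the indices of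
  the pack outside \<open>M0\<close> other than \<open>p\<close>. Validity: if some \<open>i \<in> L\<close> does not use its pack position, at most \<open>card L - 1\<close> of the
  bonus terms \<open>\<kappa> x\<^sub>i\<^sub>j\<close> are present and the rest is dominated by the knapsack constraint. Otherwise
  everything in \<open>L\<close> is bounded by the pack; if the coefficient at \<open>p\<close> is \<open>a p q\<close>, so are the
  remaining terms, and if it is \<open>a p q / D\<close> times the weight, one uses \<open>a p q / D\<close> times the knapsack
  constraint.

  Facet: a linear functional that is constant on the tight points is a multiple of the left-hand
  side. Switching \<open>p\<close> fixes the ratios of its coefficients at \<open>p\<close> and \<open>r\<close>; dropping \<open>r\<close> and
  switching \<open>i \<in> L\<close> with a value strictly below 1 leaves room to trade \<open>i\<close> against \<open>p\<close> and the
  indices in \<open>M0\<close>, so for each \<open>i\<close> the remaining ratios are fixed as well. The constants for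
  different \<open>i\<close> agree because, unless \<open>L\<close> is a singleton, one of the traded indices has positive weight.
\<close>

text \<open>A dimension squeeze. By \<open>det\<close>, the orthogonal complement of the directions
  of the face is at most a line, so the face has affine dimension at least
  \<open>DIM('v) - 1\<close>. The point \<open>y\<close> makes the face proper, hence of smaller
  dimension than \<open>C\<close>. As \<open>aff_dim C\<close> is at most \<open>DIM('v)\<close>,
  both bounds are attained, so no separate proof that \<open>C\<close> is full-dimensional is
  required.\<close>

lemma facet_definingI:
  fixes v x0 y :: "'v::euclidean_space"
  assumes valid: "valid_ineq (\<lambda>x. v \<bullet> x) \<beta> C" and "convex C"
    and y: "y \<in> C" "v \<bullet> y \<noteq> \<beta>" and x0: "x0 \<in> C" "v \<bullet> x0 = \<beta>"
    and det: "\<And>g. (\<And>x. x \<in> C \<Longrightarrow> v \<bullet> x = \<beta> \<Longrightarrow> g \<bullet> x = g \<bullet> x0) \<Longrightarrow> g \<in> span {v}"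
  shows "facet_defining (\<lambda>x. v \<bullet> x) \<beta> C"
proof -
  define F where "F = {x \<in> C. v \<bullet> x = \<beta>}"
  have x0F: "x0 \<in> F" using x0 by (simp add: F_def)
  have face: "F face_of C"
    using face_of_Int_supporting_hyperplane_le[OF \<open>convex C\<close>, of v \<beta>] valid
    by (auto simp: F_def valid_ineq_def Int_def)
  moreover have "F \<noteq> C" using y by (auto simp: F_def)
  ultimately have lt: "aff_dim F < aff_dim C"
    using face_of_aff_dim_lt[OF \<open>convex C\<close>] by blast
  define W where "W = span ((\<lambda>x. x - x0) ` F)"
  have "{u. \<forall>w\<in>W. orthogonal w u} \<subseteq> span {v}"
  proof
    fix g assume g: "g \<in> {u. \<forall>w\<in>W. orthogonal w u}"
    show "g \<in> span {v}"
    proof (rule det)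
      fix x assume "x \<in> C" "v \<bullet> x = \<beta>"
      then have "x - x0 \<in> W" by (auto simp: W_def F_def intro!: span_base)
      with g have "orthogonal (x - x0) g" by blast
      then show "g \<bullet> x = g \<bullet> x0"
        by (simp add: orthogonal_def inner_diff_left inner_commute[of g])
    qed
  qed
  then have "dim {u. \<forall>w\<in>W. orthogonal w u} \<le> dim (span {v})"
    by (rule dim_subset)
  also have "\<dots> \<le> 1" using dim_le_card'[of "{v}"] by (simp only: dim_span) simp
  finally have "dim {u. \<forall>w\<in>W. orthogonal w u} \<le> 1" .
  moreover have "dim {u \<in> UNIV. \<forall>w\<in>W. orthogonal w u} + dim W = dim (UNIV :: 'v set)"
    by (rule dim_subspace_orthogonal_to_vectors) (auto simp: W_def)
  moreover have "aff_dim F = int (dim W)"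
    using aff_dim_eq_dim_subtract[of x0 F] x0F by (simp add: W_def hull_inc)
  moreover have "aff_dim C \<le> int (DIM('v))" by (rule aff_dim_le_DIM)
  ultimately have "aff_dim F = aff_dim C - 1" using lt by (simp add: dim_UNIV)
  then show ?thesis
    using valid face x0F by (auto simp: facet_defining_def facet_of_def F_def)
qed

section \<open>Instances, and feasible points coded by one entry per group\<close>

locale ck_instance =
  fixes m :: nat and n :: "nat \<Rightarrow> nat" and a :: "nat \<Rightarrow> nat \<Rightarrow> real" and b :: real
    and ix :: "nat \<Rightarrow> nat \<Rightarrow> 'k::finite"
  assumes labelling: "coordinate_labelling m n ix"
    and standing: "ck_standing m n a b"
begin

lemma b_pos: "0 < b"
  using standing by (simp add: ck_standing_def)

lemma n_ge_1: "i \<in> {1..m} \<Longrightarrow> 1 \<le> n i"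
  using standing by (simp add: ck_standing_def)

lemma a_nonneg: "i \<in> {1..m} \<Longrightarrow> j \<in> {1..n i} \<Longrightarrow> 0 \<le> a i j"
  using standing by (auto simp: ck_standing_def index_set_def)

lemma a_antimono:
  "i \<in> {1..m} - M0 m n \<Longrightarrow> j \<in> {1..n i} \<Longrightarrow> j' \<in> {1..n i} \<Longrightarrow> j \<le> j' \<Longrightarrow> a i j' \<le> a i j"
  using standing unfolding ck_standing_def by blast

lemma sum_labelling: "(\<Sum>k\<in>UNIV. h k) = (\<Sum>i\<in>{1..m}. \<Sum>j\<in>{1..n i}. h (ix i j))"
proof -
  have "(\<Sum>k\<in>UNIV. h k) = (\<Sum>x\<in>index_set m n. h (case x of (i, j) \<Rightarrow> ix i j))"
    using labelling unfolding coordinate_labelling_def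
    by (rule sum.reindex_bij_betw[symmetric])
  also have "\<dots> = (\<Sum>i\<in>{1..m}. \<Sum>j\<in>{1..n i}. h (ix i j))"
    by (simp add: index_set_def sum.Sigma split_def)
  finally show ?thesis .
qed

text \<open>Turns a doubly indexed array into a vector, both for points and for normals of
  inequalities, so that the left-hand side can be treated as an inner product.\<close>

definition of_matrix :: "(nat \<Rightarrow> nat \<Rightarrow> real) \<Rightarrow> real^'k" where
  "of_matrix g = (\<chi> k. case inv_into (index_set m n) (\<lambda>(i, j). ix i j) k of (i, j) \<Rightarrow> g i j)"

lemma of_matrix_nth:
  assumes "i \<in> {1..m}" "j \<in> {1..n i}"
  shows "of_matrix g $ ix i j = g i j"
proof -
  have "inj_on (\<lambda>(i, j). ix i j) (index_set m n)"
    using labelling by (simp add: coordinate_labelling_def bij_betw_def)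
  moreover have "(i, j) \<in> index_set m n" using assms by (simp add: index_set_def)
  ultimately show ?thesis
    using inv_into_f_f[of "\<lambda>(i, j). ix i j" "index_set m n" "(i, j)"]
    by (simp add: of_matrix_def)
qed

lemma vec_eqI_labelling:
  fixes x y :: "real^'k"
  assumes "\<And>i j. i \<in> {1..m} \<Longrightarrow> j \<in> {1..n i} \<Longrightarrow> x $ ix i j = y $ ix i j"
  shows "x = y"
proof -
  have "x $ k = y $ k" for k
  proof -
    have "k \<in> (\<lambda>(i, j). ix i j) ` index_set m n"
      using labelling by (simp add: coordinate_labelling_def bij_betw_def)
    then show ?thesis using assms by (auto simp: index_set_def)
  qed
  then show ?thesis by (simp add: vec_eq_iff)
qed

lemma inner_labelling:
  "(g :: real^'k) \<bullet> x = (\<Sum>i\<in>{1..m}. \<Sum>j\<in>{1..n i}. g $ ix i j * x $ ix i j)"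
  by (simp add: inner_vec_def sum_labelling)

text \<open>
  By complementarity a feasible point has at most one nonzero entry per group, so it is given by
  the positions \<open>J\<close> of these entries and their values \<open>z\<close>.
\<close>

definition choice_point :: "(nat \<Rightarrow> nat) \<Rightarrow> (nat \<Rightarrow> real) \<Rightarrow> real^'k" where
  "choice_point J z = of_matrix (\<lambda>i j. if j = J i then z i else 0)"

definition choice_sum ::
    "(nat \<Rightarrow> nat \<Rightarrow> real) \<Rightarrow> (nat \<Rightarrow> nat) \<Rightarrow> (nat \<Rightarrow> real) \<Rightarrow> real" where
  "choice_sum g J z = (\<Sum>i\<in>{1..m}. g i (J i) * z i)"

definition choice :: "(nat \<Rightarrow> nat) \<Rightarrow> (nat \<Rightarrow> real) \<Rightarrow> bool" where
  "choice J z \<longleftrightarrow> (\<forall>i\<in>{1..m}. J i \<in> {1..n i} \<and> 0 \<le> z i \<and> z i \<le> 1)"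

lemma choice_upd:
  assumes "choice J z" "j \<in> {1..n i}" "0 \<le> v" "v \<le> 1"
  shows "choice (J(i := j)) (z(i := v))"
  using assms by (simp add: choice_def)

text \<open>All later tight points are modifications of one base point in a few groups. Applied with
  \<open>g = a\<close> and with \<open>g = coef\<close>, this evaluates their weight and left-hand
  side.\<close>

lemma choice_sum_upd:
  assumes "i \<in> {1..m}"
  shows "choice_sum g (J(i := j)) (z(i := v)) =
    choice_sum g J z - g i (J i) * z i + g i j * v"
proof -
  have "(\<Sum>l\<in>{1..m} - {i}. g l ((J(i := j)) l) * (z(i := v)) l) =
      (\<Sum>l\<in>{1..m} - {i}. g l (J l) * z l)"
    by (rule sum.cong) auto
  then show ?thesis using assms by (simp add: choice_sum_def sum.remove)
qed

lemma sum_choice_point: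
  assumes "choice J z"
  shows "(\<Sum>i\<in>{1..m}. \<Sum>j\<in>{1..n i}. g i j * choice_point J z $ ix i j) = choice_sum g J z"
proof -
  have "(\<Sum>j\<in>{1..n i}. g i j * choice_point J z $ ix i j) = g i (J i) * z i" if "i \<in> {1..m}" for i
  proof -
    have "(\<Sum>j\<in>{1..n i}. g i j * choice_point J z $ ix i j) =
        (\<Sum>j\<in>{1..n i}. if J i = j then g i j * z i else 0)"
      using that by (intro sum.cong) (auto simp: choice_point_def of_matrix_nth)
    then show ?thesis using assms that by (simp add: choice_def)
  qed
  then show ?thesis by (simp add: choice_sum_def)
qed

lemma inner_choice_point:
  assumes "choice J z"
  shows "g \<bullet> choice_point J z = choice_sum (\<lambda>i j. g $ ix i j) J z"
  using sum_choice_point[OF assms, of "\<lambda>i j. g $ ix i j"] by (simp add: inner_labelling)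

lemma inner_of_matrix_choice_point:
  assumes "choice J z"
  shows "of_matrix g \<bullet> choice_point J z = choice_sum g J z"
  using sum_choice_point[OF assms, of g] by (simp add: inner_labelling of_matrix_nth)

lemma choice_point_in_ck_set:
  assumes "choice J z" "choice_sum a J z \<le> b"
  shows "choice_point J z \<in> ck_set m n a b ix"
  using assms sum_choice_point[OF assms(1), of a]
  by (auto simp: ck_set_def choice_def choice_point_def of_matrix_nth)

lemma ck_setE:
  assumes x: "x \<in> ck_set m n a b ix"
  obtains J z where "choice J z" "choice_sum a J z \<le> b" "x = choice_point J z"
proof -
  \<comment> \<open>A group that vanishes entirely gets the default position 1, which exists since
    \<open>n i\<close> is at least 1. Its value is then read off \<open>x\<close> as 0.\<close>
  define J where "J i = (if \<exists>j\<in>{1..n i}. x $ ix i j \<noteq> 0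
    then SOME j. j \<in> {1..n i} \<and> x $ ix i j \<noteq> 0 else 1)" for i
  define z where "z i = x $ ix i (J i)" for i
  have J: "J i \<in> {1..n i} \<and> x $ ix i (J i) \<noteq> 0"
    if "j \<in> {1..n i}" "x $ ix i j \<noteq> 0" for i j
  proof -
    have "J i = (SOME j. j \<in> {1..n i} \<and> x $ ix i j \<noteq> 0)"
      unfolding J_def using that by (intro if_P) blast
    then show ?thesis using that by (simp only:) (rule someI, blast)
  qed
  have Jin: "J i \<in> {1..n i}" if "i \<in> {1..m}" for i
  proof (cases "\<exists>j\<in>{1..n i}. x $ ix i j \<noteq> 0")
    case True
    then show ?thesis using J by blast
  next
    case False
    then have "J i = 1" unfolding J_def by (rule if_not_P)
    then show ?thesis using n_ge_1[OF that] by simp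
  qed
  have zero: "x $ ix i j = 0" if "i \<in> {1..m}" "j \<in> {1..n i}" "j \<noteq> J i" for i j
  proof (rule ccontr)
    assume nz: "x $ ix i j \<noteq> 0"
    then have "x $ ix i (J i) \<noteq> 0" using J that(2) by blast
    moreover have "x $ ix i j * x $ ix i (J i) = 0"
      using x that Jin[OF that(1)] by (simp add: ck_set_def)
    ultimately show False using nz by simp
  qed
  have ch: "choice J z"
    using x Jin by (simp add: choice_def z_def ck_set_def)
  have xeq: "x = choice_point J z"
    by (rule vec_eqI_labelling) (simp add: choice_point_def of_matrix_nth z_def zero)
  show ?thesis
    using that[OF ch _ xeq] x sum_choice_point[OF ch, of a] by (simp add: ck_set_def flip: xeq)
qed

end

section \<open>The lifted inequality as a linear functional\<close>

locale lifted_pack = ck_instance m n a b ix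
  for m n a b and ix :: "nat \<Rightarrow> nat \<Rightarrow> 'k::finite" +
  fixes P :: "(nat \<times> nat) set" and p q r :: nat
  assumes pack: "pack m n a b P"
    and card_ge_2: "card (M_of m n P - M0 m n) \<ge> 2"
    and pq_in: "(p, q) \<in> P" and p_notin_M0: "p \<notin> M0 m n" and q_eq: "q = n p"
    and r_in: "r \<in> M_of m n P \<inter> M0 m n"
begin

abbreviation MP :: "nat set" where "MP \<equiv> M_of m n P"
abbreviation L :: "nat set" where "L \<equiv> MP - M0 m n - {p}"
definition \<delta> :: real where "\<delta> = b - weight a P"
definition D :: real where "D = a p q + \<delta>"
definition \<kappa> :: real where "\<kappa> = \<delta> * (1 + a r 1 / D)"
text \<open>\<open>L\<close> omits \<open>p\<close>, so the 2 subtracted in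
  \<open>lifted_rhs\<close> becomes a 1.\<close>

definition \<beta> :: real where "\<beta> = b + (real (card L) - 1) * \<kappa>"
definition pick :: "nat \<Rightarrow> nat" where "pick i = (SOME j. (i, j) \<in> P)"

text \<open>The coefficients of \<open>lifted_lhs\<close>, collected per variable (see
  \<open>lhs_eq\<close>). Since \<open>r\<close> and \<open>p\<close> belong to \<open>MP\<close>,
  they have to be tested before it. For \<open>i \<in> L\<close> the pack entry receives the bonus
  \<kappa> on top of its weight.\<close>

definition coef :: "nat \<Rightarrow> nat \<Rightarrow> real" where
  "coef i j =
    (if i = r then a p q * a r 1 / D
     else if i = p then a p q * (if j = q then 1 else max 1 (a p j / D))
     else if i \<in> MP then a i j + (if i \<in> L \<and> j = pick i then \<kappa> else 0)
     else 0)"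

lemma MP_subset: "MP \<subseteq> {1..m}" by (auto simp: M_of_def)

lemma finite_MP: "finite MP" using MP_subset finite_subset by blast

lemma P_index: "(i, j) \<in> P \<Longrightarrow> i \<in> {1..m} \<and> j \<in> {1..n i}"
  using pack by (auto simp: pack_def index_set_def)

text \<open>Injectivity of \<open>fst\<close> makes the pack the graph of a function on
  \<open>MP\<close>, so sums over \<open>P\<close> become sums over \<open>MP\<close>.\<close>

lemma P_iff: "(i, j) \<in> P \<longleftrightarrow> i \<in> MP \<and> j = pick i"
proof -
  have *: "(i, pick i) \<in> P" if "(i, j) \<in> P" for i j
    unfolding pick_def using that by (rule someI)
  have "j = pick i" if "(i, j) \<in> P"
    using that *[OF that] pack inj_onD[of fst P "(i, j)" "(i, pick i)"] by (simp add: pack_def)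
  then show ?thesis using * P_index by (auto simp: M_of_def)
qed

lemma pick_in: "i \<in> MP \<Longrightarrow> pick i \<in> {1..n i}"
  using P_iff P_index by blast

lemma P_eq: "P = (\<lambda>i. (i, pick i)) ` MP"
  using P_iff by auto

lemma weight_eq: "weight a P = (\<Sum>i\<in>MP. a i (pick i))"
  unfolding weight_def by (subst P_eq) (simp add: sum.reindex inj_on_def)

lemma p_in: "p \<in> MP" and pick_p: "pick p = q"
  using pq_in P_iff by auto

lemma r_in_MP: "r \<in> MP" and n_r: "n r = 1" and r_neq_p: "r \<noteq> p" and r_le: "r \<in> {1..m}"
  and r_notin_L: "r \<notin> L"
  using r_in p_notin_M0 by (auto simp: M0_def)

lemma p_le: "p \<in> {1..m}" using p_in MP_subset by blast

lemma pick_r: "pick r = 1" using pick_in[OF r_in_MP] n_r by simp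

lemma n_p: "2 \<le> n p" using n_ge_1[OF p_le] p_notin_M0 p_le by (auto simp: M0_def)

lemma \<delta>_pos: "0 < \<delta>" using pack by (simp add: \<delta>_def pack_def)

lemma apq_nonneg: "0 \<le> a p q" using a_nonneg[OF p_le] n_p by (simp add: q_eq)

lemma ar_nonneg: "0 \<le> a r 1" using a_nonneg[OF r_le] n_r by simp

lemma D_pos: "0 < D" using \<delta>_pos apq_nonneg by (simp add: D_def)

lemma \<kappa>_pos: "0 < \<kappa>" using \<delta>_pos D_pos ar_nonneg by (simp add: \<kappa>_def add_pos_nonneg)

lemma MP_split: "MP = insert r (insert p (MP - {r, p}))"
  using p_in r_in_MP by blast

lemma sum_MP: "(\<Sum>i\<in>MP. f i) = f r + f p + (\<Sum>i\<in>MP - {r, p}. f i)" for f :: "nat \<Rightarrow> real"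
  by (subst MP_split) (simp add: r_neq_p finite_MP add.assoc)

lemma card_L: "card (MP - M0 m n) = Suc (card L)"
  using card.remove[of "MP - M0 m n" p] p_in p_notin_M0 finite_MP by simp

lemma finite_L: "finite L" using finite_MP by blast

lemma coef_r: "coef r j = a p q * a r 1 / D" by (simp add: coef_def)

lemma coef_pq: "coef p q = a p q" using r_neq_p by (simp add: coef_def)

lemma coef_outside: "i \<notin> MP \<Longrightarrow> coef i j = 0"
  using p_in r_in_MP by (auto simp: coef_def)

text \<open>The identity behind all tightness computations: the coefficient of \<open>r\<close> and
  one bonus together equal the room obtained by dropping \<open>r\<close>, namely its weight plus
  the slack \<delta> of the pack.\<close>

lemma \<kappa>_eq: "a p q * a r 1 / D + \<kappa> = \<delta> + a r 1"
proof -
  have "a p q * a r 1 / D + \<kappa> = \<delta> + a r 1 * ((a p q + \<delta>) / D)"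
    using D_pos by (simp add: \<kappa>_def field_simps)
  then show ?thesis using D_pos by (simp flip: D_def)
qed

lemma rhs_eq: "lifted_rhs m n a b P p q r = \<beta>"
  by (simp add: lifted_rhs_def Let_def \<beta>_def \<kappa>_def \<delta>_def D_def card_L add_diff_eq mult.assoc)

lemma lhs_eq: "lifted_lhs m n a b ix P p q r x = of_matrix coef \<bullet> x"
proof -
  define y where "y i j = x $ ix i j" for i j
  have "of_matrix coef \<bullet> x = (\<Sum>i\<in>{1..m}. \<Sum>j\<in>{1..n i}. coef i j * y i j)"
    by (simp add: inner_labelling of_matrix_nth y_def)
  also have "\<dots> = (\<Sum>i\<in>MP. \<Sum>j\<in>{1..n i}. coef i j * y i j)"
  proof (rule sum.mono_neutral_right)
    show "\<forall>i\<in>{1..m} - MP. (\<Sum>j\<in>{1..n i}. coef i j * y i j) = 0"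
      by (simp add: coef_outside)
  qed (use MP_subset finite_MP in auto)
  also have "\<dots> = a p q * a r 1 / D * y r 1 + (\<Sum>j\<in>{1..n p}. coef p j * y p j)
      + (\<Sum>i\<in>MP - {r, p}. \<Sum>j\<in>{1..n i}. coef i j * y i j)"
    by (simp add: sum_MP n_r coef_def)
  also have "(\<Sum>j\<in>{1..n p}. coef p j * y p j) = a p q * y p q
      + (\<Sum>j\<in>{1..n p} - {q}. a p q * max 1 (a p j / D) * y p j)"
    using n_p r_neq_p by (subst sum.remove[of _ q]) (auto simp: coef_def simp flip: q_eq)
  also have "(\<Sum>i\<in>MP - {r, p}. \<Sum>j\<in>{1..n i}. coef i j * y i j) =
      (\<Sum>i\<in>MP - {r, p}. (\<Sum>j\<in>{1..n i}. a i j * y i j) + (if i \<in> L then \<kappa> * y i (pick i) else 0))"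
  proof (rule sum.cong[OF refl])
    fix i assume i: "i \<in> MP - {r, p}"
    have "(\<Sum>j\<in>{1..n i}. coef i j * y i j) =
        (\<Sum>j\<in>{1..n i}. a i j * y i j + (if pick i = j then (if i \<in> L then \<kappa> * y i j else 0) else 0))"
      using i by (intro sum.cong) (auto simp: coef_def algebra_simps)
    then show "(\<Sum>j\<in>{1..n i}. coef i j * y i j) =
        (\<Sum>j\<in>{1..n i}. a i j * y i j) + (if i \<in> L then \<kappa> * y i (pick i) else 0)"
      using i pick_in[of i] by (simp add: sum.distrib)
  qed
  also have "\<dots> = (\<Sum>i\<in>MP - {r, p}. \<Sum>j\<in>{1..n i}. a i j * y i j) +
      (\<Sum>i\<in>L. \<kappa> * y i (pick i))"
  proof -
    have "(\<Sum>i\<in>MP - {r, p}. if i \<in> L then \<kappa> * y i (pick i) else 0) = (\<Sum>i\<in>L. \<kappa> * y i (pick i))"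
      using finite_MP r_notin_L by (intro sum.mono_neutral_cong_right) auto
    then show ?thesis by (simp add: sum.distrib)
  qed
  also have "(\<Sum>i\<in>L. \<kappa> * y i (pick i)) =
      (\<Sum>(i, j)\<in>{(i, j) \<in> P. i \<in> MP - M0 m n - {p}}. \<kappa> * y i j)"
  proof -
    have "{(i, j) \<in> P. i \<in> MP - M0 m n - {p}} = (\<lambda>i. (i, pick i)) ` L"
      using P_iff by auto
    then show ?thesis by (simp add: sum.reindex inj_on_def)
  qed
  finally show ?thesis
    by (simp add: lifted_lhs_def Let_def y_def \<kappa>_def \<delta>_def D_def algebra_simps)
qed

lemma choice_sum_coef:
  assumes "choice J z"
  shows "choice_sum coef J z = a p q * a r 1 / D * z r + coef p (J p) * z p
    + (\<Sum>i\<in>MP - {r, p}. a i (J i) * z i) + \<kappa> * (\<Sum>i\<in>L. if J i = pick i then z i else 0)"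
proof -
  have "choice_sum coef J z = (\<Sum>i\<in>MP. coef i (J i) * z i)"
    unfolding choice_sum_def
    by (rule sum.mono_neutral_right) (use MP_subset in \<open>auto simp: coef_outside\<close>)
  also have "\<dots> = a p q * a r 1 / D * z r + coef p (J p) * z p
      + (\<Sum>i\<in>MP - {r, p}. coef i (J i) * z i)"
    by (simp add: sum_MP coef_def)
  also have "(\<Sum>i\<in>MP - {r, p}. coef i (J i) * z i) =
      (\<Sum>i\<in>MP - {r, p}. a i (J i) * z i +
        (if i \<in> L then \<kappa> * (if J i = pick i then z i else 0) else 0))"
    by (rule sum.cong) (auto simp: coef_def algebra_simps)
  also have "\<dots> = (\<Sum>i\<in>MP - {r, p}. a i (J i) * z i) +
      (\<Sum>i\<in>L. \<kappa> * (if J i = pick i then z i else 0))"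
  proof -
    have "(\<Sum>i\<in>MP - {r, p}. if i \<in> L then \<kappa> * (if J i = pick i then z i else 0) else 0) =
        (\<Sum>i\<in>L. \<kappa> * (if J i = pick i then z i else 0))"
      using finite_MP r_notin_L by (intro sum.mono_neutral_cong_right) auto
    then show ?thesis by (simp add: sum.distrib)
  qed
  finally show ?thesis by (simp add: sum_distrib_left algebra_simps)
qed

section \<open>Validity\<close>

lemma choice_sum_le:
  assumes ch: "choice J z" and knap: "choice_sum a J z \<le> b"
  shows "choice_sum coef J z \<le> \<beta>"
proof -
  define W where "W = (\<Sum>i\<in>MP - {r, p}. a i (J i) * z i)"
  define T where "T = (\<Sum>i\<in>L. if J i = pick i then z i else 0)"
  define \<alpha> where "\<alpha> = a p q"
  define \<rho> where "\<rho> = a r 1"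
  define A where "A = a p (J p)"
  have z: "0 \<le> z i" "z i \<le> 1" "J i \<in> {1..n i}" if "i \<in> {1..m}" for i
    using ch that by (auto simp: choice_def)
  have nn: "0 \<le> \<alpha>" "0 \<le> \<rho>" "0 < D" "0 < \<delta>" "0 < \<kappa>" "D = \<alpha> + \<delta>" "\<alpha> \<le> D"
    using apq_nonneg ar_nonneg D_pos \<delta>_pos \<kappa>_pos by (simp_all add: \<alpha>_def \<rho>_def D_def)
  have Jr: "J r = 1" using z(3)[OF r_le] n_r by simp
  have "(\<Sum>i\<in>MP. a i (J i) * z i) \<le> choice_sum a J z"
    unfolding choice_sum_def
    by (rule sum_mono2) (use MP_subset z a_nonneg in auto)
  then have knap': "\<rho> * z r + A * z p + W \<le> b"
    using knap by (simp add: sum_MP W_def A_def \<rho>_def Jr)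
  have lhs: "choice_sum coef J z = \<alpha> * \<rho> / D * z r + coef p (J p) * z p + W + \<kappa> * T"
    by (simp add: choice_sum_coef[OF ch] W_def T_def \<alpha>_def \<rho>_def)
  have "\<alpha> \<le> A"
    unfolding \<alpha>_def A_def q_eq
    by (rule a_antimono) (use p_le p_notin_M0 z(3)[OF p_le] n_p in auto)
  \<comment> \<open>The first case covers both \<open>J p = q\<close> and a maximum equal to 1; in
    the second case the coefficient at \<open>p\<close> is the weight scaled by
    \<open>\<alpha> / D\<close>, as it is at \<open>r\<close>.\<close>
  have coef_p: "coef p (J p) = \<alpha> \<or> \<alpha> \<le> A \<and> coef p (J p) = \<alpha> * A / D"
    using r_neq_p \<open>\<alpha> \<le> A\<close> by (auto simp: coef_def \<alpha>_def A_def max_def)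
  have AD: "\<alpha> * x / D \<le> x" if "0 \<le> x" for x
    using that nn mult_right_mono[of \<alpha> D x] by (simp add: divide_simps mult.commute)
  have \<kappa>D: "\<kappa> = \<delta> / D * (D + \<rho>)" using nn by (simp add: \<kappa>_def \<rho>_def field_simps)
  show ?thesis
  proof (cases "\<forall>i\<in>L. J i = pick i")
    case True
    have T: "T \<le> real (card L)"
    proof -
      have "T \<le> (\<Sum>i\<in>L. 1)"
        unfolding T_def by (rule sum_mono) (use z MP_subset in auto)
      then show ?thesis by simp
    qed
    have "W \<le> (\<Sum>i\<in>MP - {r, p}. a i (pick i))"
      unfolding W_def
    proof (rule sum_mono)
      fix i assume i: "i \<in> MP - {r, p}"
      then have im: "i \<in> {1..m}" using MP_subset by blast
      have "J i = pick i"
      proof (cases "i \<in> M0 m n")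
        case True
        then show ?thesis using pick_in[of i] z(3)[OF im] i by (simp add: M0_def)
      next
        case False
        then show ?thesis using \<open>\<forall>i\<in>L. J i = pick i\<close> i by blast
      qed
      then show "a i (J i) * z i \<le> a i (pick i)"
        using mult_left_mono[of "z i" 1 "a i (J i)"] a_nonneg[OF im z(3)[OF im]] z[OF im] by simp
    qed
    also have "\<dots> = weight a P - \<alpha> - \<rho>"
      by (simp add: weight_eq sum_MP pick_p pick_r \<alpha>_def \<rho>_def)
    \<comment> \<open>The whole pack weighs \<open>b - \<delta>\<close>; removing \<open>p\<close>
      and \<open>r\<close> from it frees another \<open>\<alpha> + \<rho>\<close>, and
      \<open>D = \<alpha> + \<delta>\<close>.\<close>
    finally have W: "W \<le> b - D - \<rho>" by (simp add: D_def \<delta>_def \<alpha>_def)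
    have \<kappa>T: "\<kappa> * T \<le> \<kappa> * card L" using T nn by simp
    show ?thesis using coef_p
    proof
      assume c: "coef p (J p) = \<alpha>"
      have "\<alpha> * z p \<le> \<alpha>" using nn z(2)[OF p_le] by (simp add: mult_left_le)
      moreover have "\<alpha> * \<rho> / D * z r \<le> \<alpha> * \<rho> / D"
        using nn(1-3) z(2)[OF r_le] mult_left_mono[of "z r" 1 "\<alpha> * \<rho> / D"] by simp
      moreover have "\<alpha> * \<rho> / D + \<kappa> = \<delta> + \<rho>"
        using \<kappa>_eq by (simp add: \<alpha>_def \<rho>_def)
      moreover have "\<beta> = b + \<kappa> * card L - \<kappa>" by (simp add: \<beta>_def algebra_simps)
      ultimately show ?thesis
        unfolding lhs c using \<kappa>T W nn(6) by linarith
    next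
      assume c: "\<alpha> \<le> A \<and> coef p (J p) = \<alpha> * A / D"
      have "\<alpha> * \<rho> / D * z r + \<alpha> * A / D * z p = \<alpha> / D * (\<rho> * z r + A * z p)"
        using nn(3) by (simp add: field_simps)
      also have "\<dots> \<le> \<alpha> / D * (b - W)"
        using knap' nn by (intro mult_left_mono) auto
      finally have 1: "\<alpha> * \<rho> / D * z r + \<alpha> * A / D * z p \<le> \<alpha> / D * (b - W)" .
      \<comment> \<open>After scaling the knapsack constraint, the loss
        \<open>\<delta> / D * (b - W)\<close> has to pay for the one bonus missing from \<beta>. It
        does, because \<open>b - W\<close> is at least \<open>D + \<rho>\<close>.\<close>
      have "\<alpha> / D = 1 - \<delta> / D" using nn(3,6) by (simp add: field_simps)
      then have "\<alpha> / D * (b - W) = b - W - \<delta> / D * (b - W)"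
        by (simp add: left_diff_distrib)
      moreover have "\<kappa> \<le> \<delta> / D * (b - W)"
        unfolding \<kappa>D using W nn by (intro mult_left_mono) auto
      moreover have "\<beta> = b + \<kappa> * card L - \<kappa>" by (simp add: \<beta>_def algebra_simps)
      ultimately show ?thesis
        unfolding lhs c[THEN conjunct2] using 1 \<kappa>T by linarith
    qed
  next
    case False
    then obtain i0 where i0: "i0 \<in> L" "J i0 \<noteq> pick i0" by blast
    \<comment> \<open>The group \<open>i0\<close> earns no bonus, so the remaining bonuses fit into
      \<beta>. All other coefficients are at most the weights, because \<open>\<alpha> / D\<close>
      is at most 1.\<close>
    have "T = (\<Sum>i\<in>L - {i0}. if J i = pick i then z i else 0)"
      unfolding T_def using i0 by (subst sum.remove[OF finite_L i0(1)]) simp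
    also have "\<dots> \<le> (\<Sum>i\<in>L - {i0}. 1)"
      by (rule sum_mono) (use z MP_subset in auto)
    also have "\<dots> = real (card L) - 1"
      using card.remove[OF finite_L i0(1)] by simp
    finally have \<kappa>T: "\<kappa> * T \<le> \<kappa> * (real (card L) - 1)" using nn by simp
    have "\<alpha> * \<rho> / D * z r \<le> \<rho> * z r"
      using AD[OF nn(2)] z[OF r_le] by (intro mult_right_mono)
    moreover have "coef p (J p) * z p \<le> A * z p"
      using coef_p \<open>\<alpha> \<le> A\<close> AD[of A] nn z[OF p_le] by (intro mult_right_mono) auto
    ultimately show ?thesis
      using \<kappa>T knap' by (simp add: lhs \<beta>_def mult.commute)
  qed
qed

lemma valid: "valid_ineq (\<lambda>x. of_matrix coef \<bullet> x) \<beta> (ck_polytope m n a b ix)"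
proof -
  have "ck_set m n a b ix \<subseteq> {x. of_matrix coef \<bullet> x \<le> \<beta>}"
    by (auto elim!: ck_setE simp: inner_of_matrix_choice_point choice_sum_le)
  then have "ck_polytope m n a b ix \<subseteq> {x. of_matrix coef \<bullet> x \<le> \<beta>}"
    unfolding ck_polytope_def by (rule hull_minimal) (rule convex_halfspace_le)
  then show ?thesis by (auto simp: valid_ineq_def)
qed

lemma valid_lifted:
  "valid_ineq (lifted_lhs m n a b ix P p q r) (lifted_rhs m n a b P p q r)
    (ck_polytope m n a b ix)"
  using valid unfolding valid_ineq_def lhs_eq rhs_eq .

end

section \<open>Tight points and the facet property\<close>

locale switching_pack = lifted_pack m n a b ix P p q r
  for m n a b and ix :: "nat \<Rightarrow> nat \<Rightarrow> 'k::finite" and P p q r +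
  assumes switching: "maximal_switching_pack m n a b (P - {(r, 1)})"
    and nondegenerate: "a p q > 0 \<or> card (M_of m n P - M0 m n) = 2 \<or>
      (\<exists>i \<in> M_of m n P \<inter> M0 m n - {r}. a i 1 > 0)"
begin

text \<open>\<open>E i\<close> is the room left for \<open>i\<close> when the pack entries of \<open>i\<close> and \<open>r\<close> are removed.\<close>

definition E :: "nat \<Rightarrow> real" where "E i = \<delta> + a r 1 + a i (n i)"
text \<open>With the positions \<open>n\<close> this gives the incidence vector of \<open>P\<close>
  (by \<open>pick_eq\<close>), the base point from which the other tight points arise by changing at
  most three groups.\<close>

definition z0 :: "nat \<Rightarrow> real" where "z0 i = (if i \<in> MP then 1 else 0)"

definition tight :: "(nat \<Rightarrow> nat) \<Rightarrow> (nat \<Rightarrow> real) \<Rightarrow> bool" where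
  "tight J z \<longleftrightarrow> choice J z \<and> choice_sum a J z \<le> b \<and> choice_sum coef J z = \<beta>"

lemma pick_eq: "i \<in> MP \<Longrightarrow> pick i = n i"
  using switching P_iff[of i "pick i"] pick_r n_r
  by (cases "i = r") (auto simp: maximal_switching_pack_def)

text \<open>The switching condition concerns the pack without \<open>(r, 1)\<close>; rearranged, it
  says \<open>E i < a i (n i - 1)\<close>, and smaller \<open>j\<close> have larger weights. Hence
  the value \<open>E i / a i j\<close> that fills the room after a switch is strictly below
  1.\<close>

lemma E_less:
  assumes i: "i \<in> MP - M0 m n" and j: "j \<in> {1..n i}" "j \<noteq> n i"
  shows "E i < a i j"
proof -
  have "(r, 1) \<in> P" using r_in_MP pick_r by (simp add: P_iff)
  moreover have "finite P" by (subst P_eq) (simp add: finite_MP)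
  ultimately have "weight a (P - {(r, 1)}) = weight a P - a r 1"
    by (simp add: weight_def sum_diff1)
  moreover have "i \<in> M_of m n (P - {(r, 1)})"
    using i r_in P_iff[of i "pick i"] pick_in[of i] MP_subset
    by (auto simp: M_of_def intro!: bexI[of _ "pick i"])
  then have "weight a (P - {(r, 1)}) - a i (n i) + a i (n i - 1) > b"
    using switching i by (auto simp: maximal_switching_pack_def)
  moreover have "a i (n i - 1) \<le> a i j"
    by (rule a_antimono) (use i j MP_subset in auto)
  ultimately show ?thesis by (simp add: E_def \<delta>_def)
qed

lemma E_pos: "i \<in> MP \<Longrightarrow> 0 < E i"
  using \<delta>_pos ar_nonneg a_nonneg[of i "n i"] n_ge_1[of i] MP_subset
  by (force simp: E_def intro!: add_pos_nonneg)

lemma choice_z0: "choice n z0"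
  using n_ge_1 by (auto simp: choice_def z0_def)

lemma choice_sum_z0: "choice_sum a n z0 = b - \<delta>"
proof -
  have "choice_sum a n z0 = (\<Sum>i\<in>MP. a i (n i))"
    unfolding choice_sum_def z0_def using MP_subset
    by (intro sum.mono_neutral_cong_right) auto
  then show ?thesis by (simp add: weight_eq pick_eq \<delta>_def)
qed

lemma choice_sum_coef_z0: "choice_sum coef n z0 = \<beta>"
proof -
  have "(\<Sum>i\<in>MP - {r, p}. a i (n i) * z0 i) = (\<Sum>i\<in>MP - {r, p}. a i (pick i))"
    by (rule sum.cong) (auto simp: z0_def pick_eq)
  also have "\<dots> = b - D - a r 1"
    using sum_MP[of "\<lambda>i. a i (pick i)"]
    by (simp add: weight_eq[symmetric] pick_p pick_r D_def \<delta>_def)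
  finally have 1: "(\<Sum>i\<in>MP - {r, p}. a i (n i) * z0 i) = b - D - a r 1" .
  have "(\<Sum>i\<in>L. if n i = pick i then z0 i else 0) = (\<Sum>i\<in>L. 1)"
    by (rule sum.cong) (auto simp: z0_def pick_eq)
  then have 2: "(\<Sum>i\<in>L. if n i = pick i then z0 i else 0) = real (card L)" by simp
  have "choice_sum coef n z0 =
      a p q * a r 1 / D + a p q + (b - D - a r 1) + \<kappa> * real (card L)"
    using r_in_MP p_in
    by (simp add: choice_sum_coef[OF choice_z0] 1 2 coef_pq flip: q_eq) (simp add: z0_def)
  moreover have "\<beta> = b + \<kappa> * card L - \<kappa>" by (simp add: \<beta>_def algebra_simps)
  ultimately show ?thesis using \<kappa>_eq D_def by linarith
qed

lemma tight_z0: "tight n z0"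
  using choice_z0 choice_sum_z0 choice_sum_coef_z0 \<delta>_pos by (simp add: tight_def)

text \<open>Variables outside \<open>MP\<close> do not enter the left-hand side, and the base point
  leaves slack \<delta>. The chosen value is positive, at most 1, and uses at most \<delta>.\<close>

lemma tight_outside:
  assumes "i \<in> {1..m} - MP" "j \<in> {1..n i}"
  shows "tight (n(i := j)) (z0(i := \<delta> / (a i j + \<delta>)))"
proof -
  have nn: "0 \<le> a i j" using a_nonneg assms by auto
  have "a i j * (\<delta> / (a i j + \<delta>)) \<le> \<delta>"
    using nn \<delta>_pos by (simp add: divide_simps algebra_simps)
  moreover have "coef i j = 0" using assms by (simp add: coef_outside)
  ultimately show ?thesis
    using assms nn \<delta>_pos choice_sum_z0 choice_sum_coef_z0
    by (auto simp: tight_def choice_sum_upd z0_def intro!: choice_upd choice_z0)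
qed

text \<open>As \<open>E p = D + a r 1\<close>, switching forces \<open>a p j > D\<close>, so the
  maximum in the coefficient is its second argument.\<close>

lemma coef_p:
  assumes "j \<in> {1..n p}" "j \<noteq> q"
  shows "coef p j = a p q * a p j / D" and "D + a r 1 < a p j"
proof -
  show less: "D + a r 1 < a p j"
    using E_less[of p j] assms p_in p_notin_M0 by (simp add: E_def D_def flip: q_eq)
  show "coef p j = a p q * a p j / D"
    using less assms D_pos ar_nonneg r_neq_p by (simp add: coef_def max_def field_simps)
qed

text \<open>Removing the entry at \<open>p\<close> leaves room \<open>D\<close>, and removing
  \<open>r\<close> as well leaves \<open>D + a r 1\<close>; the new value at \<open>p\<close> fills
  this room exactly. The first point relates the coefficients at \<open>p\<close> to each other, the
  second relates them to \<open>r\<close>.\<close>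

lemma tight_p:
  assumes j: "j \<in> {1..n p}" "j \<noteq> q"
  shows "tight (n(p := j)) (z0(p := D / a p j))"
    and "tight (n(r := 1, p := j)) (z0(r := 0, p := (D + a r 1) / a p j))"
proof -
  note less = coef_p(2)[OF j]
  have z: "z0 p = 1" "z0 r = 1" using p_in r_in_MP by (simp_all add: z0_def)
  have pos: "0 < a p j" using less D_pos ar_nonneg by linarith
  show "tight (n(p := j)) (z0(p := D / a p j))"
    using less pos D_pos ar_nonneg choice_sum_z0 choice_sum_coef_z0 j
    by (auto simp: tight_def choice_sum_upd[OF p_le] z coef_pq coef_p(1) D_def
        simp flip: q_eq intro!: choice_upd choice_z0)
  have "a p q * a p j / D * ((D + a r 1) / a p j) = a p q + a p q * a r 1 / D"
    using pos D_pos by (simp add: field_simps)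
  then have "choice_sum coef (n(r := 1, p := j)) (z0(r := 0, p := (D + a r 1) / a p j)) = \<beta>"
    using choice_sum_coef_z0 j r_neq_p n_r
    by (simp add: choice_sum_upd[OF p_le] choice_sum_upd[OF r_le] z coef_pq coef_r coef_p(1)
        flip: q_eq)
  moreover have "choice_sum a (n(r := 1, p := j)) (z0(r := 0, p := (D + a r 1) / a p j)) = b"
    using pos choice_sum_z0 r_neq_p n_r
    by (simp add: choice_sum_upd[OF p_le] choice_sum_upd[OF r_le] z D_def flip: q_eq)
  ultimately show "tight (n(r := 1, p := j)) (z0(r := 0, p := (D + a r 1) / a p j))"
    unfolding tight_def using less D_pos ar_nonneg j n_r by (auto intro!: choice_upd choice_z0)
qed

lemma coef_L:
  assumes "i \<in> L"
  shows "coef i (n i) = a i (n i) + \<kappa>" and "j \<noteq> n i \<Longrightarrow> coef i j = a i j"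
    and "i \<noteq> r" and "i \<noteq> p" and "i \<in> {1..m}" and "z0 i = 1"
  using assms r_notin_L pick_eq[of i] MP_subset by (auto simp: coef_def z0_def)

text \<open>\<open>E i\<close> is thus also the amount of left-hand side lost when \<open>r\<close>
  and the pack entry of \<open>i \<in> L\<close> are removed. A position of \<open>i\<close> outside
  the pack has its weight as coefficient, so filling the room there restores the lost
  amount.\<close>

lemma E_eq: "E i = a p q * a r 1 / D + \<kappa> + a i (n i)"
using \<kappa>_eq by (simp add: E_def)

lemma tight_L:
  assumes i: "i \<in> L" and j: "j \<in> {1..n i}" "j \<noteq> n i"
  shows "tight (n(r := 1, i := j)) (z0(r := 0, i := E i / a i j))"
proof -
  have less: "E i < a i j" and Ep: "0 < E i" using E_less[of i j] E_pos[of i] i j by auto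
  note ci = coef_L[OF i]
  have z: "z0 r = 1" using r_in_MP by (simp add: z0_def)
  have 1: "choice_sum a (n(r := 1, i := j)) (z0(r := 0, i := E i / a i j)) = b"
    using less Ep ci(3) choice_sum_z0 n_r
    by (simp add: choice_sum_upd[OF ci(5)] choice_sum_upd[OF r_le] z ci(6) E_def)
  have 2: "choice_sum coef (n(r := 1, i := j)) (z0(r := 0, i := E i / a i j)) = \<beta>"
    using less Ep ci(3) choice_sum_coef_z0 n_r j
    by (simp add: choice_sum_upd[OF ci(5)] choice_sum_upd[OF r_le] z coef_r ci(1,2,6) E_eq)
  show ?thesis
    unfolding tight_def using 1 2 less Ep j n_r by (auto intro!: choice_upd choice_z0)
qed

text \<open>The switched entry of \<open>i\<close> is still below 1 and can take over some weight
  from \<open>l\<close>. At both positions the coefficient equals the weight, so this trade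
  preserves the weight and the left-hand side alike.\<close>

lemma tight_L_transfer:
  assumes i: "i \<in> L" and j: "j \<in> {1..n i}" "j \<noteq> n i" and l: "l = p \<or> l \<in> MP \<inter> M0 m n - {r}"
  obtains \<epsilon> where "0 < \<epsilon>"
    "tight (n(r := 1, i := j, l := n l)) (z0(r := 0, i := (E i + \<epsilon> * a l (n l)) / a i j, l := 1 - \<epsilon>))"
proof -
  have less: "E i < a i j" and Ep: "0 < E i" using E_less[of i j] E_pos[of i] i j by auto
  note ci = coef_L[OF i]
  have z: "z0 r = 1" using r_in_MP by (simp add: z0_def)
  have l': "l \<noteq> r" "l \<noteq> i" "z0 l = 1" "l \<in> {1..m}" "coef l (n l) = a l (n l)"
    using l i r_neq_p p_in MP_subset by (auto simp: z0_def coef_def simp flip: q_eq)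
  have al: "0 \<le> a l (n l)" using a_nonneg n_ge_1 l'(4) by auto
  \<comment> \<open>Chosen to be positive, at most 1, and with \<open>\<epsilon> * a l (n l)\<close>
    within the gap \<open>a i j - E i\<close>, also when \<open>l\<close> has weight 0.\<close>
  define \<epsilon> where "\<epsilon> = (a i j - E i) / (a i j - E i + a l (n l))"
  have \<epsilon>: "0 < \<epsilon>" "\<epsilon> \<le> 1" using less al by (auto simp: \<epsilon>_def)
  have "\<epsilon> * a l (n l) \<le> a i j - E i"
    using less al by (simp add: \<epsilon>_def divide_simps mult_left_mono)
  then have le: "(E i + \<epsilon> * a l (n l)) / a i j \<le> 1" using less Ep by simp
  let ?J = "n(r := 1, i := j, l := n l)"
  let ?z = "z0(r := 0, i := (E i + \<epsilon> * a l (n l)) / a i j, l := 1 - \<epsilon>)"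
  have 1: "choice_sum a ?J ?z = b"
    using less Ep ci(3) choice_sum_z0 n_r l'
    by (simp add: choice_sum_upd[OF ci(5)] choice_sum_upd[OF l'(4)] choice_sum_upd[OF r_le] z ci(6)
        right_diff_distrib) (simp add: E_def)
  have 2: "choice_sum coef ?J ?z = \<beta>"
    using less Ep ci(3) choice_sum_coef_z0 n_r j l'
    by (simp add: choice_sum_upd[OF ci(5)] choice_sum_upd[OF l'(4)] choice_sum_upd[OF r_le] z coef_r
        ci(1,2,6) right_diff_distrib) (simp add: E_eq)
  have "tight ?J ?z"
    unfolding tight_def using 1 2 less Ep j n_r \<epsilon> le al n_ge_1[OF l'(4)]
    by (auto intro!: choice_upd choice_z0)
  with \<epsilon>(1) show ?thesis by (rule that)
qed

text \<open>The hypothesis \<open>det\<close> of \<open>facet_definingI\<close> in coordinates: each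
  family of tight points above yields one group of linear equations for \<open>G\<close>.\<close>

lemma coef_unique:
  assumes G: "\<And>J z. tight J z \<Longrightarrow> choice_sum G J z = choice_sum G n z0"
  obtains \<mu> where "\<And>i j. i \<in> {1..m} \<Longrightarrow> j \<in> {1..n i} \<Longrightarrow> G i j = \<mu> * coef i j"
proof -
  have z: "z0 p = 1" "z0 r = 1" using p_in r_in_MP by (simp_all add: z0_def)
  have outside: "G i j = 0" if "i \<in> {1..m} - MP" "j \<in> {1..n i}" for i j
  proof -
    have "0 \<le> a i j" using a_nonneg that by auto
    then show ?thesis
      using G[OF tight_outside[OF that]] that \<delta>_pos
      by (auto simp: choice_sum_upd z0_def)
  qed
  have Gp: "G p j = G p q * a p j / D" and Gr: "G r 1 = G p q * a r 1 / D"
    if "j \<in> {1..n p}" "j \<noteq> q" for j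
  proof -
    have pos: "0 < a p j" using coef_p(2)[OF that] D_pos ar_nonneg by linarith
    have "G p j * (D / a p j) = G p q"
      using G[OF tight_p(1)[OF that]] by (simp add: choice_sum_upd[OF p_le] z flip: q_eq)
    then show Gp: "G p j = G p q * a p j / D" using pos D_pos by (simp add: field_simps)
    have "G p j * ((D + a r 1) / a p j) = G p q + G r 1"
      using G[OF tight_p(2)[OF that]] r_neq_p n_r
      by (simp add: choice_sum_upd[OF p_le] choice_sum_upd[OF r_le] z flip: q_eq)
    then show "G r 1 = G p q * a r 1 / D"
      unfolding Gp using pos D_pos by (simp add: field_simps)
  qed
  \<comment> \<open>Position 1 discharges the assumptions on \<open>j\<close>, since
    \<open>n p\<close> is at least 2.\<close>
  have Gr: "G r 1 = G p q * a r 1 / D" using Gr[of 1] n_p by (simp add: q_eq)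
  \<comment> \<open>The candidate multiplier seen from \<open>i\<close>: the quotient by
    \<open>E i\<close> is what the tight points of \<open>tight_L\<close> force on all positions of
    \<open>i\<close> outside the pack.\<close>
  define \<nu> where "\<nu> i = (G r 1 + G i (n i)) / E i" for i
  have GL: "G i j = \<nu> i * a i j" if i: "i \<in> L" and j: "j \<in> {1..n i}" "j \<noteq> n i" for i j
  proof -
    have less: "E i < a i j" and Ep: "0 < E i" using E_less[of i j] E_pos[of i] i j by auto
    note ci = coef_L[OF i]
    have "G i j * (E i / a i j) = G r 1 + G i (n i)"
      using G[OF tight_L[OF that]] n_r ci(3)
      by (simp add: choice_sum_upd[OF ci(5)] choice_sum_upd[OF r_le] z ci(6))
    then show ?thesis using less Ep by (simp add: \<nu>_def field_simps)
  qed
  have n_L: "1 \<in> {1..n i}" "1 \<noteq> n i" if "i \<in> L" for i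
    using that n_ge_1[of i] MP_subset by (auto simp: M0_def)
  have Gl: "G l (n l) = \<nu> i * a l (n l)"
    if i: "i \<in> L" and l: "l = p \<or> l \<in> MP \<inter> M0 m n - {r}" for i l
  proof -
    note ci = coef_L[OF i]
    note j = n_L[OF i]
    have less: "E i < a i 1" and Ep: "0 < E i" using E_less[of i 1] E_pos[of i] i j by auto
    obtain \<epsilon> where \<epsilon>: "0 < \<epsilon>" "tight (n(r := 1, i := 1, l := n l))
        (z0(r := 0, i := (E i + \<epsilon> * a l (n l)) / a i 1, l := 1 - \<epsilon>))"
      by (rule tight_L_transfer[OF i j l])
    have l': "l \<noteq> r" "l \<noteq> i" "z0 l = 1" "l \<in> {1..m}"
      using l i r_neq_p p_in MP_subset by (auto simp: z0_def)
    have "G i 1 * ((E i + \<epsilon> * a l (n l)) / a i 1) = G r 1 + G i (n i) + \<epsilon> * G l (n l)"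
      using G[OF \<epsilon>(2)] n_r ci(3) l'
      by (simp add: choice_sum_upd[OF ci(5)] choice_sum_upd[OF l'(4)] choice_sum_upd[OF r_le]
          z ci(6) algebra_simps)
    moreover have "G r 1 + G i (n i) = \<nu> i * E i" using Ep by (simp add: \<nu>_def)
    moreover have "G i 1 * ((E i + \<epsilon> * a l (n l)) / a i 1) = \<nu> i * (E i + \<epsilon> * a l (n l))"
      using GL[OF i j] less Ep by simp
    moreover have "\<nu> i * (E i + \<epsilon> * a l (n l)) = \<nu> i * E i + \<epsilon> * (\<nu> i * a l (n l))"
      by (simp add: algebra_simps)
    ultimately have "\<epsilon> * G l (n l) = \<epsilon> * (\<nu> i * a l (n l))" by linarith
    then show ?thesis using \<epsilon>(1) by simp
  qed
  have "card L \<noteq> 0" using card_ge_2 card_L by simp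
  then obtain i0 where i0: "i0 \<in> L" by (metis card.empty ex_in_conv)
  define \<mu> where "\<mu> = \<nu> i0"
  \<comment> \<open>With several indices in \<open>L\<close>, \<open>nondegenerate\<close> supplies
    an \<open>l\<close> of positive weight that can be traded against each of them; the coefficient
    of \<open>G\<close> at \<open>l\<close> then determines every \<open>\<nu> i\<close>.\<close>
  have \<nu>: "\<nu> i = \<mu>" if i: "i \<in> L" for i
  proof (cases "card L = 1")
    case True
    then show ?thesis using i i0 by (metis \<mu>_def card_1_singletonE singletonD)
  next
    case False
    then have "a p (n p) > 0 \<or> (\<exists>l \<in> MP \<inter> M0 m n - {r}. a l 1 > 0)"
      using nondegenerate card_L by (simp add: q_eq)
    moreover have "n l = 1" if "l \<in> MP \<inter> M0 m n - {r}" for l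
      using that by (simp add: M0_def)
    ultimately obtain l where l: "l = p \<or> l \<in> MP \<inter> M0 m n - {r}" and "a l (n l) > 0"
      by metis
    then show ?thesis using Gl[OF i l] Gl[OF i0 l] by (simp add: \<mu>_def)
  qed
  have Gpq: "G p q = \<mu> * a p q" using Gl[OF i0, of p] by (simp add: \<mu>_def flip: q_eq)
  show ?thesis
  proof (rule that[of \<mu>])
    fix i j assume i: "i \<in> {1..m}" and j: "j \<in> {1..n i}"
    consider "i \<notin> MP" | "i = r" | "i = p" | "i \<in> MP \<inter> M0 m n - {r}" | "i \<in> L" "j \<noteq> n i"
      | "i \<in> L" "j = n i" by blast
    then show "G i j = \<mu> * coef i j"
    proof cases
      case 1
      then show ?thesis using outside[of i j] i j p_in r_in_MP by (auto simp: coef_def)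
    next
      case 2
      then show ?thesis using j n_r Gr Gpq by (simp add: coef_def)
    next
      case 3
      then show ?thesis
        using Gp[of j] j coef_p(1)[of j] Gpq r_neq_p by (cases "j = q") (simp_all add: coef_def)
    next
      case 4
      moreover have "j = n i" using 4 j by (simp add: M0_def)
      moreover have "i \<noteq> p" using 4 p_notin_M0 by blast
      ultimately show ?thesis using Gl[OF i0, of i] by (simp add: coef_def \<mu>_def)
    next
      case 5
      then show ?thesis using GL[of i j] j \<nu> coef_L(2)[of i j] by simp
    next
      case 6
      \<comment> \<open>The definition of \<open>\<nu> i\<close>, solved for the pack entry of
        \<open>i\<close>.\<close>
      then have "G i (n i) = \<mu> * E i - G r 1"
        using \<nu>[of i] E_pos[of i] by (simp add: \<nu>_def field_simps)
      also have "\<dots> = \<mu> * (E i - a p q * a r 1 / D)"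
        using Gr Gpq by (simp add: right_diff_distrib)
      also have "E i - a p q * a r 1 / D = coef i (n i)"
        using 6 coef_L(1)[of i] E_eq[of i] by simp
      finally show ?thesis using 6 by simp
    qed
  qed
qed

lemma facet: "facet_defining (\<lambda>x. of_matrix coef \<bullet> x) \<beta> (ck_polytope m n a b ix)"
proof (rule facet_definingI[OF valid])
  let ?C = "ck_polytope m n a b ix"
  have inC: "choice_point J z \<in> ?C" if "choice J z" "choice_sum a J z \<le> b" for J z
    unfolding ck_polytope_def using choice_point_in_ck_set[OF that] by (rule hull_inc)
  show "convex ?C" by (simp add: ck_polytope_def)
  have 0: "choice n (\<lambda>_. 0)" using choice_z0 by (simp add: choice_def)
  \<comment> \<open>The origin serves as the point off the face. It is not tight because \<beta> is
    positive, \<open>card L\<close> being at least 1.\<close>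
  show "choice_point n (\<lambda>_. 0) \<in> ?C"
    using b_pos by (intro inC 0) (simp add: choice_sum_def)
  have "0 < \<beta>"
    using b_pos \<kappa>_pos card_ge_2 card_L by (simp add: \<beta>_def add_pos_nonneg)
  then show "of_matrix coef \<bullet> choice_point n (\<lambda>_. 0) \<noteq> \<beta>"
    by (simp add: inner_of_matrix_choice_point[OF 0] choice_sum_def)
  show "choice_point n z0 \<in> ?C"
    using tight_z0 by (auto simp: tight_def intro: inC)
  show "of_matrix coef \<bullet> choice_point n z0 = \<beta>"
    using tight_z0 by (simp add: tight_def inner_of_matrix_choice_point)
  fix g :: "real^'k"
  assume g: "\<And>x. x \<in> ?C \<Longrightarrow> of_matrix coef \<bullet> x = \<beta> \<Longrightarrow> g \<bullet> x = g \<bullet> choice_point n z0"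
  have "choice_sum (\<lambda>i j. g $ ix i j) J z = choice_sum (\<lambda>i j. g $ ix i j) n z0" if "tight J z" for J z
    using g[of "choice_point J z"] that inC[of J z] inner_of_matrix_choice_point[of J z coef]
      inner_choice_point[of J z g] inner_choice_point[OF choice_z0, of g]
    by (simp add: tight_def)
  then obtain \<mu> where "\<And>i j. i \<in> {1..m} \<Longrightarrow> j \<in> {1..n i} \<Longrightarrow> g $ ix i j = \<mu> * coef i j"
    using coef_unique[of "\<lambda>i j. g $ ix i j"] by blast
  then have "g = \<mu> *\<^sub>R of_matrix coef"
    by (intro vec_eqI_labelling) (simp add: of_matrix_nth)
  then show "g \<in> span {of_matrix coef}" by (simp add: span_mul span_base)
qed

lemma facet_lifted:
  "facet_defining (lifted_lhs m n a b ix P p q r) (lifted_rhs m n a b P p q r)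
    (ck_polytope m n a b ix)"
  using facet unfolding facet_defining_def valid_ineq_def lhs_eq rhs_eq .

end

theorem theorem7:
  fixes m :: nat and n :: "nat \<Rightarrow> nat" and a :: "nat \<Rightarrow> nat \<Rightarrow> real" and b :: real
    and ix :: "nat \<Rightarrow> nat \<Rightarrow> 'k::finite"
    and P :: "(nat \<times> nat) set" and istar jstar i' :: nat
  assumes "coordinate_labelling m n ix"
    and "ck_standing m n a b"
    and "pack m n a b P"
    and "card (M_of m n P - M0 m n) \<ge> 2"
    and "(istar, jstar) \<in> P" and "istar \<notin> M0 m n" and "jstar = n istar"
    and "i' \<in> M_of m n P \<inter> M0 m n"
  shows "valid_ineq (lifted_lhs m n a b ix P istar jstar i')
           (lifted_rhs m n a b P istar jstar i') (ck_polytope m n a b ix) \<and>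
         (maximal_switching_pack m n a b (P - {(i', 1)}) \<and>
            (a istar jstar > 0 \<or> card (M_of m n P - M0 m n) = 2 \<or>
              (\<exists>i \<in> M_of m n P \<inter> M0 m n - {i'}. a i 1 > 0)) \<longrightarrow>
          facet_defining (lifted_lhs m n a b ix P istar jstar i')
            (lifted_rhs m n a b P istar jstar i') (ck_polytope m n a b ix))"
proof -
  have lifted: "lifted_pack m n a b ix P istar jstar i'"
    by unfold_locales (use assms in auto)
  show ?thesis
  proof (intro conjI impI)
    show "valid_ineq (lifted_lhs m n a b ix P istar jstar i')
        (lifted_rhs m n a b P istar jstar i') (ck_polytope m n a b ix)"
      using lifted by (rule lifted_pack.valid_lifted)
  next
    assume "maximal_switching_pack m n a b (P - {(i', 1)}) \<and>
      (a istar jstar > 0 \<or> card (M_of m n P - M0 m n) = 2 \<or>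
        (\<exists>i \<in> M_of m n P \<inter> M0 m n - {i'}. a i 1 > 0))"
    then have "switching_pack m n a b ix P istar jstar i'"
      by (intro switching_pack.intro switching_pack_axioms.intro lifted) auto
    then show "facet_defining (lifted_lhs m n a b ix P istar jstar i')
        (lifted_rhs m n a b P istar jstar i') (ck_polytope m n a b ix)"
      by (rule switching_pack.facet_lifted)
  qed
qed

end
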